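(* Let $0<\gamma\le1$, $1<\alpha\le2$, and $c(x,t)\ge 0$. Suppose the step sizes satisfy $$0<\frac{\tau^{\gamma}}{(\Delta x)^{\alpha}}\le-\frac{\Gamma(4-\alpha)(1-2^{-\gamma})}{4\kappa_\alpha C_{\max}\Gamma(2-\gamma)(1-2^{1-\alpha})},\qquad C_{\max}=\max_{0\le i\le N_x,\,0\le k\le N_t}c(x_i,t_k).$$ Then the explicit difference scheme (defined in the context) for the one-dimensional time-space Caputo-Riesz fractional diffusion equation ${}_0^C D_t^{\gamma}u(x,t)=c(x,t)\frac{\partial^{\alpha}u(x,t)}{\partial|x|^{\alpha}}+f(x,t)$ is stable. That is, if $(u_i^k)$ and $(\widetilde u_i^k)$ are two solutions of the scheme with the same $f$ and the same boundary values but possibly different initial values, and $\epsilon_i^k=\widetilde u_i^k-u_i^k$, $\|E^k\|_\infty=\max_{0\le i\le N_x}|\epsilon_i^k|$, then $\|E^k\|_\infty\le\|E^0\|_\infty$ for all $k=1,\dots,N_t$.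
   Context: Mesh: $x_i=x_L+i\Delta x$ $(0\le i\le N_x)$, $N_x\ge2$, $\Delta x=(x_R-x_L)/N_x$; $t_k=k\tau$ $(0\le k\le N_t)$, $\tau=T/N_t$. Time coefficients: $l_s=(s+1)^{1-\gamma}-s^{1-\gamma}$ for $0<\gamma<1$; for $\gamma=1$, $l_0=1$ and $l_s=0$ for $s\ge1$. Space coefficients: for $\nu\in(1,2]$, $N\ge2$, $1\le i\le N-1$, $0\le m\le N$, put $g_{i,m}^{\nu}=p_{i,m}^{\nu}+q_{i,m}^{\nu}$ (here with $N=N_x$, $\nu=\alpha$), where $p_{i,m}^{\nu}=a_{i-1,m}-2a_{i,m}+a_{i+1,m}$ for $m\le i-1$, $p_{i,i}^{\nu}=-2a_{i,i}+a_{i+1,i}$, $p_{i,i+1}^{\nu}=a_{i+1,i+1}$, $p_{i,m}^{\nu}=0$ for $m>i+1$; $q_{i,m}^{\nu}=0$ for $m<i-1$, $q_{i,i-1}^{\nu}=b_{i-1,i-1}$, $q_{i,i}^{\nu}=-2b_{i,i}+b_{i-1,i}$, $q_{i,m}^{\nu}=b_{i-1,m}-2b_{i,m}+b_{i+1,m}$ for $i+1\le m\le N$; $a_{j,0}=(j-1)^{3-\nu}-j^{2-\nu}(j-3+\nu)$ for $j\ge1$, $a_{j,m}=(j-m+1)^{3-\nu}-2(j-m)^{3-\nu}+(j-m-1)^{3-\nu}$ for $1\le m\le j-1$, $a_{j,j}=1$ for $j\ge1$, and $a_{0,0}=0$; $b_{j,j}=1$ for $j\le N-1$, $b_{j,m}=(m-j+1)^{3-\nu}-2(m-j)^{3-\nu}+(m-j-1)^{3-\nu}$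 for $j+1\le m\le N-1$, $b_{j,N}=(3-\nu-N+j)(N-j)^{2-\nu}+(N-j-1)^{3-\nu}$ for $j\le N-1$, and $b_{N,N}=0$. Further, $\kappa_\alpha=\frac{1}{2\cos(\alpha\pi/2)}<0$, $c_i^k=c(x_i,t_k)$, $f_i^k=f(x_i,t_k)$, $\mu=\Gamma(2-\gamma)\tau^\gamma$, $\sigma_{i,k}=-\frac{\Gamma(2-\gamma)\tau^{\gamma}\kappa_\alpha c_i^{k}}{\Gamma(4-\alpha)(\Delta x)^\alpha}$. Explicit scheme: given initial values $u_i^0$ and boundary values $u_0^k,u_{N_x}^k$, for $1\le i\le N_x-1$ and $0\le k\le N_t-1$, $$u_i^1=(1+\sigma_{i,0}g_{i,i}^\alpha)u_i^0+\sigma_{i,0}\sum_{m=0,m\ne i}^{N_x}g_{i,m}^\alpha u_m^0+\mu f_i^0\quad(k=0),$$ $$u_i^{k+1}=(1-l_1+\sigma_{i,k}g_{i,i}^\alpha)u_i^k+\sum_{s=1}^{k-1}(l_s-l_{s+1})u_i^{k-s}+l_ku_i^0+\sigma_{i,k}\sum_{m=0,m\ne i}^{N_x}g_{i,m}^\alpha u_m^k+\mu f_i^k\quad(k>0).$$ Two solutions with the same boundary values have $\epsilon_0^k=\epsilon_{N_x}^k=0$ for all $k$. *)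

theory Defs
  imports "HOL-Analysis.Analysis"
begin

definition dx :: "real \<Rightarrow> real \<Rightarrow> nat \<Rightarrow> real" where
  "dx xL xR Nx = (xR - xL) / real Nx"

definition xmesh :: "real \<Rightarrow> real \<Rightarrow> nat \<Rightarrow> nat \<Rightarrow> real" where
  "xmesh xL xR Nx i = xL + real i * dx xL xR Nx"

definition dt :: "real \<Rightarrow> nat \<Rightarrow> real" where
  "dt T Nt = T / real Nt"

definition tmesh :: "real \<Rightarrow> nat \<Rightarrow> nat \<Rightarrow> real" where
  "tmesh T Nt k = real k * dt T Nt"

definition lcoef :: "real \<Rightarrow> nat \<Rightarrow> real" where
  "lcoef \<gamma> s =
     (if \<gamma> = 1 then (if s = 0 then 1 else 0)
      else (real s + 1) powr (1 - \<gamma>) - real s powr (1 - \<gamma>))"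

text \<open>\<open>acoef \<nu> j m\<close> is meaningful for \<open>m \<le> j\<close> and \<open>bcoef N \<nu> j m\<close> for \<open>j \<le> m \<le> N\<close>; the value
  \<open>0\<close> outside these ranges is a dummy that is never used by \<open>pcoef\<close>, \<open>qcoef\<close> for
  \<open>1 \<le> i \<le> N - 1\<close>, \<open>m \<le> N\<close>. A zero base of \<open>powr\<close> occurs only with the exponent
  \<open>3 - \<nu> \<ge> 1\<close>, where \<open>0 powr (3 - \<nu>) = 0\<close> is the usual value.\<close>

definition acoef :: "real \<Rightarrow> nat \<Rightarrow> nat \<Rightarrow> real" where
  "acoef \<nu> j m =
     (if j = 0 then 0
      else if m = 0 then
        (real j - 1) powr (3 - \<nu>) - real j powr (2 - \<nu>) * (real j - 3 + \<nu>)
      else if m < j then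
        (real j - real m + 1) powr (3 - \<nu>) - 2 * (real j - real m) powr (3 - \<nu>)
          + (real j - real m - 1) powr (3 - \<nu>)
      else if m = j then 1
      else 0)"

definition bcoef :: "nat \<Rightarrow> real \<Rightarrow> nat \<Rightarrow> nat \<Rightarrow> real" where
  "bcoef N \<nu> j m =
     (if j \<ge> N then 0
      else if m = j then 1
      else if j < m \<and> m < N then
        (real m - real j + 1) powr (3 - \<nu>) - 2 * (real m - real j) powr (3 - \<nu>)
          + (real m - real j - 1) powr (3 - \<nu>)
      else if m = N then
        (3 - \<nu> - real N + real j) * (real N - real j) powr (2 - \<nu>)
          + (real N - real j - 1) powr (3 - \<nu>)
      else 0)"

definition pcoef :: "real \<Rightarrow> nat \<Rightarrow> nat \<Rightarrow> real" where
  "pcoef \<nu> i m =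
     (if m < i then acoef \<nu> (i - 1) m - 2 * acoef \<nu> i m + acoef \<nu> (i + 1) m
      else if m = i then - 2 * acoef \<nu> i i + acoef \<nu> (i + 1) i
      else if m = i + 1 then acoef \<nu> (i + 1) (i + 1)
      else 0)"

definition qcoef :: "nat \<Rightarrow> real \<Rightarrow> nat \<Rightarrow> nat \<Rightarrow> real" where
  "qcoef N \<nu> i m =
     (if m + 1 < i then 0
      else if m + 1 = i then bcoef N \<nu> (i - 1) (i - 1)
      else if m = i then - 2 * bcoef N \<nu> i i + bcoef N \<nu> (i - 1) i
      else bcoef N \<nu> (i - 1) m - 2 * bcoef N \<nu> i m + bcoef N \<nu> (i + 1) m)"

definition gcoef :: "nat \<Rightarrow> real \<Rightarrow> nat \<Rightarrow> nat \<Rightarrow> real" where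
  "gcoef N \<nu> i m = pcoef \<nu> i m + qcoef N \<nu> i m"

definition kappa :: "real \<Rightarrow> real" where
  "kappa \<alpha> = 1 / (2 * cos (\<alpha> * pi / 2))"

definition mu :: "real \<Rightarrow> real \<Rightarrow> nat \<Rightarrow> real" where
  "mu \<gamma> T Nt = Gamma (2 - \<gamma>) * dt T Nt powr \<gamma>"

definition sigma ::
  "real \<Rightarrow> real \<Rightarrow> real \<Rightarrow> real \<Rightarrow> nat \<Rightarrow> real \<Rightarrow> nat \<Rightarrow> (real \<Rightarrow> real \<Rightarrow> real) \<Rightarrow> nat \<Rightarrow> nat \<Rightarrow> real" where
  "sigma \<gamma> \<alpha> xL xR Nx T Nt c i k =
     - (Gamma (2 - \<gamma>) * dt T Nt powr \<gamma> * kappa \<alpha> * c (xmesh xL xR Nx i) (tmesh T Nt k))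
       / (Gamma (4 - \<alpha>) * dx xL xR Nx powr \<alpha>)"

definition C_max ::
  "real \<Rightarrow> real \<Rightarrow> nat \<Rightarrow> real \<Rightarrow> nat \<Rightarrow> (real \<Rightarrow> real \<Rightarrow> real) \<Rightarrow> real" where
  "C_max xL xR Nx T Nt c =
     Max ((\<lambda>(i, k). c (xmesh xL xR Nx i) (tmesh T Nt k)) ` ({0..Nx} \<times> {0..Nt}))"

text \<open>A grid function \<open>u\<close> is indexed as \<open>u i k\<close> for \<open>u\<^sub>i\<^sup>k\<close>. The initial values \<open>u i 0\<close> and the
  boundary values \<open>u 0 k\<close>, \<open>u Nx k\<close> are those of \<open>u\<close> itself and are left unconstrained.\<close>

definition explicit_scheme ::
  "real \<Rightarrow> real \<Rightarrow> real \<Rightarrow> real \<Rightarrow> nat \<Rightarrow> real \<Rightarrow> nat \<Rightarrow>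
    (real \<Rightarrow> real \<Rightarrow> real) \<Rightarrow> (real \<Rightarrow> real \<Rightarrow> real) \<Rightarrow> (nat \<Rightarrow> nat \<Rightarrow> real) \<Rightarrow> bool" where
  "explicit_scheme \<gamma> \<alpha> xL xR Nx T Nt c f u \<longleftrightarrow>
     (let g = gcoef Nx \<alpha>; l = lcoef \<gamma>; \<sigma> = sigma \<gamma> \<alpha> xL xR Nx T Nt c; \<mu> = mu \<gamma> T Nt;
          F = (\<lambda>i k. f (xmesh xL xR Nx i) (tmesh T Nt k))
      in \<forall>i\<in>{1..Nx - 1}.
           u i 1 = (1 + \<sigma> i 0 * g i i) * u i 0
                   + \<sigma> i 0 * (\<Sum>m\<in>{0..Nx} - {i}. g i m * u m 0) + \<mu> * F i 0
         \<and> (\<forall>k. 0 < k \<and> k \<le> Nt - 1 \<longrightarrow>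
              u i (k + 1) = (1 - l 1 + \<sigma> i k * g i i) * u i k
                + (\<Sum>s = 1..k - 1. (l s - l (s + 1)) * u i (k - s)) + l k * u i 0
                + \<sigma> i k * (\<Sum>m\<in>{0..Nx} - {i}. g i m * u m k) + \<mu> * F i k))"

definition grid_norm :: "nat \<Rightarrow> (nat \<Rightarrow> real) \<Rightarrow> real" where
  "grid_norm Nx e = Max ((\<lambda>i. \<bar>e i\<bar>) ` {0..Nx})"

text \<open>For \<open>C_max = 0\<close> the upper bound is read as \<open>+\<infinity>\<close>, i.e. it is no restriction; without the
  guard, \<open>x / 0 = 0\<close> would make the condition unsatisfiable.\<close>

definition step_condition ::
  "real \<Rightarrow> real \<Rightarrow> real \<Rightarrow> real \<Rightarrow> nat \<Rightarrow> real \<Rightarrow> nat \<Rightarrow> (real \<Rightarrow> real \<Rightarrow> real) \<Rightarrow> bool" where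
  "step_condition \<gamma> \<alpha> xL xR Nx T Nt c \<longleftrightarrow>
     (let r = dt T Nt powr \<gamma> / dx xL xR Nx powr \<alpha>; C = C_max xL xR Nx T Nt c
      in 0 < r \<and>
         (C \<noteq> 0 \<longrightarrow>
            r \<le> - (Gamma (4 - \<alpha>) * (1 - 2 powr (- \<gamma>)))
                 / (4 * kappa \<alpha> * C * Gamma (2 - \<gamma>) * (1 - 2 powr (1 - \<alpha>)))))"

end

theory Submission
  imports Defs
begin

text \<open>The error solves the homogeneous scheme with zero boundary values, so only the interior
  coefficients matter, and these are Toeplitz: \<open>g\<^sub>i\<^sub>,\<^sub>m = P (i - m) + P (m - i)\<close> with \<open>P\<close> the fourth
  difference of \<open>max 0 x powr (3 - \<alpha>)\<close>. The off-diagonal coefficients are nonnegative, and the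
  interior row sums telescope to nonpositive third differences. The step condition is exactly
  \<open>\<sigma> \<bar>g\<^sub>i\<^sub>,\<^sub>i\<bar> \<le> 1 - l\<^sub>1\<close>, because \<open>g\<^sub>i\<^sub>,\<^sub>i = - 8 (1 - 2 powr (1 - \<alpha>))\<close> and
  \<open>1 - l\<^sub>1 = 2 (1 - 2 powr (- \<gamma>))\<close>. Hence each new error value is bounded by a combination of
  earlier ones with nonnegative weights of sum at most one.\<close>

section \<open>Second differences\<close>

definition second_diff :: "(real \<Rightarrow> real) \<Rightarrow> real \<Rightarrow> real" where
  "second_diff F x = F (x + 1) - 2 * F x + F (x - 1)"

text \<open>The mean value theorem on each half gives \<open>F' z - F' y\<close> with
  \<open>y < x < z\<close>. Differentiability is asked only inside the interval, since a power may
  fail to be smooth at its left end.\<close>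

lemma second_diff_nonneg:
  fixes F F' :: "real \<Rightarrow> real"
  assumes cont: "continuous_on {x - 1..x + 1} F"
    and der: "\<And>y. x - 1 < y \<Longrightarrow> y < x + 1 \<Longrightarrow> (F has_real_derivative F' y) (at y)"
    and mono: "\<And>y z. x - 1 < y \<Longrightarrow> y \<le> z \<Longrightarrow> z < x + 1 \<Longrightarrow> F' y \<le> F' z"
  shows "0 \<le> second_diff F x"
proof -
  have mvt: "\<exists>z. a < z \<and> z < a + 1 \<and> F (a + 1) - F a = F' z" if "x - 1 \<le> a" "a + 1 \<le> x + 1" for a
  proof -
    have "continuous_on {a..a + 1} F"
      using that by (intro continuous_on_subset[OF cont]) auto
    moreover have "F differentiable (at y)" if "a < y" "y < a + 1" for y
      using der[of y] that \<open>x - 1 \<le> a\<close> \<open>a + 1 \<le> x + 1\<close>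
      by (auto simp: real_differentiable_def)
    ultimately obtain l z where z: "a < z" "z < a + 1" "DERIV F z :> l"
      "F (a + 1) - F a = (a + 1 - a) * l"
      using MVT[of a "a + 1" F] by auto
    then have "l = F' z"
      using der[of z] that by (auto intro: DERIV_unique)
    then show ?thesis using z by auto
  qed
  obtain y where y: "x - 1 < y" "y < x" "F x - F (x - 1) = F' y"
    using mvt[of "x - 1"] by auto
  obtain z where z: "x < z" "z < x + 1" "F (x + 1) - F x = F' z"
    using mvt[of x] by auto
  have "F' y \<le> F' z" using mono y z by simp
  then show ?thesis using y z by (simp add: second_diff_def)
qed

lemma second_diff_powr_nonneg:
  fixes p x :: real
  assumes "p \<le> 0" "1 < x"
  shows "0 \<le> second_diff (\<lambda>x. x powr p) x"
proof (rule second_diff_nonneg[where F' = "\<lambda>y. p * y powr (p - 1)"])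
  show "continuous_on {x - 1..x + 1} (\<lambda>x. x powr p)"
    using assms by (auto intro!: continuous_intros)
  show "((\<lambda>x. x powr p) has_real_derivative p * y powr (p - 1)) (at y)"
    if "x - 1 < y" "y < x + 1" for y
    using that assms by (intro has_real_derivative_powr) auto
  show "p * y powr (p - 1) \<le> p * z powr (p - 1)" if "x - 1 < y" "y \<le> z" "z < x + 1" for y z
    using that assms by (intro mult_left_mono_neg powr_mono2') auto
qed

lemma second_diff_powr_nonpos:
  fixes p x :: real
  assumes "0 \<le> p" "p \<le> 1" "1 < x"
  shows "second_diff (\<lambda>x. x powr p) x \<le> 0"
proof -
  have "0 \<le> second_diff (\<lambda>x. - (x powr p)) x"
  proof (rule second_diff_nonneg[where F' = "\<lambda>y. - (p * y powr (p - 1))"])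
    show "continuous_on {x - 1..x + 1} (\<lambda>x. - (x powr p))"
      using assms by (auto intro!: continuous_intros)
    show "((\<lambda>x. - (x powr p)) has_real_derivative - (p * y powr (p - 1))) (at y)"
      if "x - 1 < y" "y < x + 1" for y
      using that assms by (intro DERIV_minus has_real_derivative_powr) auto
    show "- (p * y powr (p - 1)) \<le> - (p * z powr (p - 1))"
      if "x - 1 < y" "y \<le> z" "z < x + 1" for y z
      using that assms by (auto intro!: mult_left_mono powr_mono2')
  qed
  then show ?thesis by (simp add: second_diff_def)
qed

text \<open>Each differentiation lowers the exponent by one: from [1, 2] to the concave range
  [0, 1], then to the convex range [-1, 0]. The base \<open>x - 1\<close> stays positive.\<close>

lemma DERIV_second_diff_powr:
  fixes p x :: real
  assumes "1 < x"
  shows "(second_diff (\<lambda>x. x powr p) has_real_derivative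
    p * second_diff (\<lambda>x. x powr (p - 1)) x) (at x)"
  unfolding second_diff_def[abs_def]
  using assms by (auto intro!: derivative_eq_intros simp: algebra_simps)

lemma continuous_on_second_diff_powr:
  fixes p :: real
  assumes "0 < p"
  shows "continuous_on {1..} (second_diff (\<lambda>x. x powr p))"
  unfolding second_diff_def[abs_def]
  using assms by (auto intro!: continuous_intros continuous_on_powr')

text \<open>The derivative is \<open>p\<close> times a second difference of the concave power
  \<open>p - 1\<close>. At \<open>x = 1\<close>, where the base 0 occurs, continuity
  suffices.\<close>

lemma second_diff_powr_antimono:
  fixes p x y :: real
  assumes "1 \<le> p" "p \<le> 2" "1 \<le> x" "x \<le> y"
  shows "second_diff (\<lambda>x. x powr p) y \<le> second_diff (\<lambda>x. x powr p) x"
proof (cases "x = y")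
  case False
  then have "x < y" using assms by simp
  let ?A = "second_diff (\<lambda>x. x powr p)"
  have "continuous_on {x..y} ?A"
    using assms by (intro continuous_on_subset[OF continuous_on_second_diff_powr]) auto
  moreover have "?A differentiable (at z)" if "x < z" "z < y" for z
    using DERIV_second_diff_powr[of z p] that assms by (auto simp: real_differentiable_def)
  ultimately obtain l z where z: "x < z" "z < y" "DERIV ?A z :> l" "?A y - ?A x = (y - x) * l"
    using MVT[OF \<open>x < y\<close>] by blast
  then have "l = p * second_diff (\<lambda>x. x powr (p - 1)) z"
    using DERIV_second_diff_powr[of z p] assms by (auto intro: DERIV_unique)
  then have "l \<le> 0"
    using second_diff_powr_nonpos[of "p - 1" z] assms z by (simp add: mult_nonneg_nonpos)
  then have "(y - x) * l \<le> 0" using \<open>x < y\<close> by (simp add: mult_nonneg_nonpos)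
  then show ?thesis using z by simp
qed simp

text \<open>The derivative of the inner second difference is nondecreasing, because its own
  derivative involves the convex power \<open>p - 2\<close>.\<close>

lemma fourth_diff_powr_nonneg:
  fixes p x :: real
  assumes "1 \<le> p" "p \<le> 2" "2 \<le> x"
  shows "0 \<le> second_diff (second_diff (\<lambda>x. x powr p)) x"
proof (rule second_diff_nonneg)
  let ?B = "second_diff (\<lambda>x. x powr (p - 1))"
  show "continuous_on {x - 1..x + 1} (second_diff (\<lambda>x. x powr p))"
    using assms by (intro continuous_on_subset[OF continuous_on_second_diff_powr]) auto
  show "(second_diff (\<lambda>x. x powr p) has_real_derivative p * ?B y) (at y)"
    if "x - 1 < y" "y < x + 1" for y
    using that assms by (intro DERIV_second_diff_powr) auto
  show "p * ?B y \<le> p * ?B z" if "x - 1 < y" "y \<le> z" "z < x + 1" for y z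
  proof -
    have "?B y \<le> ?B z"
    proof (rule DERIV_nonneg_imp_nondecreasing[OF \<open>y \<le> z\<close>])
      fix w assume "y \<le> w" "w \<le> z"
      then have "1 < w" using that assms by simp
      moreover have "0 \<le> (p - 1) * second_diff (\<lambda>x. x powr (p - 1 - 1)) w"
        using assms \<open>1 < w\<close> by (intro mult_nonneg_nonneg second_diff_powr_nonneg) auto
      ultimately show "\<exists>d. DERIV ?B w :> d \<and> 0 \<le> d"
        using DERIV_second_diff_powr by blast
    qed
    then show ?thesis using assms by (simp add: mult_left_mono)
  qed
qed

text \<open>This is the coefficient next to the diagonal, with \<open>p = 3 - \<nu>\<close>. It
  vanishes at \<open>p = 2\<close> and is nonincreasing up to there.\<close>

lemma three_powr_ge:
  fixes p :: real
  assumes "p \<le> 2"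
  shows "0 \<le> 3 powr p - 4 * 2 powr p + 7"
proof -
  have "3 powr 2 - 4 * 2 powr 2 + 7 \<le> 3 powr p - 4 * 2 powr p + (7 :: real)"
  proof (rule DERIV_nonpos_imp_nonincreasing[OF assms])
    fix x :: real assume "x \<le> 2"
    \<comment> \<open>Bounding \<open>(3 / 2) powr x\<close> by 9/4 reduces the sign of the
      derivative to \<open>9 * ln 3 \<le> 16 * ln 2\<close>, that is
      \<open>3 ^ 9 \<le> 2 ^ 16\<close>.\<close>
    have "(3 :: real) powr x = 2 powr x * (3 / 2) powr x"
      by (simp add: powr_divide)
    also have "\<dots> \<le> 2 powr x * (3 / 2) powr 2"
      using \<open>x \<le> 2\<close> by (intro mult_left_mono powr_mono) auto
    finally have le: "(3 :: real) powr x \<le> 2 powr x * (9 / 4)"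
      by (simp add: power2_eq_square)
    have "ln ((3 :: real) ^ 9) \<le> ln (2 ^ 16)"
      by (subst ln_le_cancel_iff) auto
    then have ln: "9 * ln (3 :: real) \<le> 16 * ln 2"
      by (simp add: ln_realpow del: power_numeral)
    have "3 powr x * ln 3 \<le> 2 powr x * (9 / 4) * ln (3 :: real)"
      using le by (intro mult_right_mono) auto
    also have "\<dots> = 2 powr x * (9 * ln 3 / 4)"
      by simp
    also have "\<dots> \<le> 2 powr x * (4 * ln (2 :: real))"
      using ln by (intro mult_left_mono) auto
    finally have "3 powr x * ln 3 - 4 * (2 powr x * ln (2 :: real)) \<le> 0"
      by simp
    moreover have "DERIV (\<lambda>p. 3 powr p - 4 * 2 powr p + (7 :: real)) x :>
        3 powr x * ln 3 - 4 * (2 powr x * ln 2)"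
      by (auto intro!: derivative_eq_intros simp: mult.commute)
    ultimately show "\<exists>y. DERIV (\<lambda>p. 3 powr p - 4 * 2 powr p + (7 :: real)) x :> y \<and> y \<le> 0"
      by blast
  qed
  then show ?thesis by simp
qed

section \<open>The spatial coefficients\<close>

text \<open>\<open>toepA p n\<close> is the second difference of \<open>max 0 x powr p\<close> at the integer \<open>n\<close>.\<close>

definition toepA :: "real \<Rightarrow> int \<Rightarrow> real" where
  "toepA p n = (if n < 0 then 0 else if n = 0 then 1 else second_diff (\<lambda>x. x powr p) (of_int n))"

text \<open>Naming this first difference lets sums of \<open>toepP\<close> telescope.\<close>

definition toepD :: "real \<Rightarrow> int \<Rightarrow> real" where
  "toepD p n = toepA p (n + 1) - toepA p n"

definition toepP :: "real \<Rightarrow> int \<Rightarrow> real" where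
  "toepP p n = toepD p n - toepD p (n - 1)"

lemma acoef_eq: "1 \<le> m \<Longrightarrow> m \<le> j \<Longrightarrow> acoef \<nu> j m = toepA (3 - \<nu>) (int j - int m)"
  by (auto simp: acoef_def toepA_def second_diff_def)

lemma bcoef_eq: "j \<le> m \<Longrightarrow> m < N \<Longrightarrow> bcoef N \<nu> j m = toepA (3 - \<nu>) (int m - int j)"
  by (auto simp: bcoef_def toepA_def second_diff_def)

text \<open>The zero extension of \<open>toepA\<close> to negative arguments absorbs the cases of
  \<open>pcoef\<close>. Column 0 is excluded because its coefficients have another form.\<close>

lemma pcoef_eq:
  assumes "1 \<le> m" "1 \<le> i"
  shows "pcoef \<nu> i m = toepP (3 - \<nu>) (int i - int m)"
proof -
  consider "m < i" | "m = i" | "m = i + 1" | "i + 1 < m" by linarith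
  then show ?thesis
  proof cases
    case 1
    then show ?thesis using assms
      by (simp add: pcoef_def acoef_eq toepP_def toepD_def of_nat_diff algebra_simps)
  next
    case 4
    then show ?thesis by (simp add: pcoef_def toepP_def toepD_def toepA_def)
  qed (use assms in \<open>simp_all add: pcoef_def acoef_eq toepP_def toepD_def toepA_def\<close>)
qed

lemma qcoef_eq:
  assumes "1 \<le> m" "m < N" "1 \<le> i"
  shows "qcoef N \<nu> i m = toepP (3 - \<nu>) (int m - int i)"
proof -
  consider "i < m" | "m = i" | "i = m + 1" | "m + 1 < i" by linarith
  then show ?thesis
  proof cases
    case 1
    then show ?thesis using assms
      by (simp add: qcoef_def bcoef_eq toepP_def toepD_def of_nat_diff algebra_simps)
  next
    case 2
    then show ?thesis using assms
      by (simp add: qcoef_def bcoef_eq toepP_def toepD_def toepA_def of_nat_diff)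
  next
    case 4
    then show ?thesis by (simp add: qcoef_def toepP_def toepD_def toepA_def)
  qed (use assms in \<open>simp_all add: qcoef_def bcoef_eq toepP_def toepD_def toepA_def\<close>)
qed

lemma gcoef_eq:
  assumes "1 \<le> m" "m < N" "1 \<le> i"
  shows "gcoef N \<nu> i m = toepP (3 - \<nu>) (int i - int m) + toepP (3 - \<nu>) (int m - int i)"
  using assms by (simp add: gcoef_def pcoef_eq qcoef_eq)

text \<open>On the diagonal both Toeplitz terms equal \<open>2 powr (3 - \<nu>) - 4\<close>.\<close>

lemma gcoef_diag:
  assumes "1 \<le> i" "i < N"
  shows "gcoef N \<nu> i i = - 8 * (1 - 2 powr (1 - \<nu>))"
proof -
  have "2 powr (3 - \<nu>) = 2 powr (2 + (1 - \<nu>))" by simp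
  also have "\<dots> = 4 * 2 powr (1 - \<nu>)" by (simp only: powr_add) simp
  finally show ?thesis using assms
    by (simp add: gcoef_eq toepP_def toepD_def toepA_def second_diff_def)
qed

text \<open>For \<open>n \<ge> 2\<close> the reflected term vanishes and \<open>toepP\<close> is a
  true fourth difference with bases from \<open>n - 2\<close> on. For \<open>n = 1\<close> the base
  -1 would occur; there the reflected term adds 1 and \<open>three_powr_ge\<close> applies.\<close>

lemma toepP_sym_nonneg:
  assumes "1 \<le> p" "p \<le> 2" "n \<ge> 1"
  shows "0 \<le> toepP p n + toepP p (- n)"
proof (cases "n = 1")
  case True
  then show ?thesis using three_powr_ge[OF \<open>p \<le> 2\<close>]
    by (simp add: toepP_def toepD_def toepA_def second_diff_def)
next
  case False
  then have "toepP p (- n) = 0" using assms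
    by (simp add: toepP_def toepD_def toepA_def)
  moreover have "toepP p n = second_diff (second_diff (\<lambda>x. x powr p)) (of_int n)"
    using False assms by (simp add: toepP_def toepD_def toepA_def second_diff_def)
  ultimately show ?thesis
    using fourth_diff_powr_nonneg[of p "of_int n"] False assms by simp
qed

lemma gcoef_offdiag_nonneg:
  assumes "1 < \<nu>" "\<nu> \<le> 2" "1 \<le> m" "m < N" "1 \<le> i" "i \<noteq> m"
  shows "0 \<le> gcoef N \<nu> i m"
proof (cases "m < i")
  case True
  then show ?thesis
    using toepP_sym_nonneg[of "3 - \<nu>" "int i - int m"] assms by (simp add: gcoef_eq)
next
  case False
  then show ?thesis
    using toepP_sym_nonneg[of "3 - \<nu>" "int m - int i"] assms by (simp add: gcoef_eq add.commute)
qed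

lemma sum_toepP_down:
  "1 \<le> N \<Longrightarrow> (\<Sum>m\<in>{1..<N}. toepP p (int i - int m)) = toepD p (int i - 1) - toepD p (int i - int N)"
  by (induction N rule: dec_induct) (simp_all add: toepP_def algebra_simps)

lemma sum_toepP_up:
  "1 \<le> N \<Longrightarrow> (\<Sum>m\<in>{1..<N}. toepP p (int m - int i)) = toepD p (int N - int i - 1) - toepD p (- int i)"
  by (induction N rule: dec_induct) (simp_all add: toepP_def algebra_simps)

text \<open>At \<open>n = 0\<close> the difference \<open>toepD p n\<close> may be positive. It occurs only in rows adjacent to
  the boundary, where it is compensated by the term \<open>toepD p (- 1) = 1\<close>.\<close>

lemma toepD_bound:
  assumes "1 \<le> p" "p \<le> 2" "0 \<le> n"
  shows "toepD p n \<le> (if n = 0 then 1 else 0)"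
proof (cases "n = 0")
  case True
  have "2 powr p \<le> (2 :: real) powr 2" using assms by (intro powr_mono) auto
  then show ?thesis using True by (simp add: toepD_def toepA_def second_diff_def)
next
  case False
  then show ?thesis
    using second_diff_powr_antimono[of p "of_int n" "of_int n + 1"] assms
    by (simp add: toepD_def toepA_def)
qed

lemma toepD_neg: "n < 0 \<Longrightarrow> toepD p n = (if n = - 1 then 1 else 0)"
  by (auto simp: toepD_def toepA_def)

lemma gcoef_interior_row_sum:
  assumes "1 < \<nu>" "\<nu> \<le> 2" "1 \<le> i" "i < N"
  shows "(\<Sum>m\<in>{1..<N}. gcoef N \<nu> i m) \<le> 0"
proof -
  let ?D = "toepD (3 - \<nu>)"
  have "(\<Sum>m\<in>{1..<N}. gcoef N \<nu> i m)
      = (\<Sum>m\<in>{1..<N}. toepP (3 - \<nu>) (int i - int m) + toepP (3 - \<nu>) (int m - int i))"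
    using assms by (intro sum.cong) (auto simp: gcoef_eq)
  also have "\<dots> = ?D (int i - 1) - ?D (- int i) + (?D (int N - int i - 1) - ?D (int i - int N))"
    using assms by (simp only: sum.distrib sum_toepP_down sum_toepP_up)
  also have "\<dots> \<le> 0"
    \<comment> \<open>\<open>int i - 1 = 0\<close> exactly when \<open>- int i = - 1\<close>, so an
      excess of at most 1 meets a subtracted 1; likewise at the other end.\<close>
    using toepD_bound[of "3 - \<nu>" "int i - 1"] toepD_bound[of "3 - \<nu>" "int N - int i - 1"] assms
    by (auto simp: toepD_neg split: if_splits)
  finally show ?thesis .
qed

text \<open>The self-weight \<open>w\<close> is 1 in the first time step and
  \<open>1 - lcoef \<gamma> 1\<close> later. The off-diagonal mass is at most
  \<open>- gcoef N \<nu> i i\<close>, so the diagonal contributions cancel.\<close>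

lemma space_step_bound:
  fixes e :: "nat \<Rightarrow> real"
  assumes "1 < \<nu>" "\<nu> \<le> 2" "1 \<le> i" "i < N" "0 \<le> \<sigma>"
    and diag: "0 \<le> w + \<sigma> * gcoef N \<nu> i i"
    and bnd: "e 0 = 0" "e N = 0" and M: "\<And>m. m \<le> N \<Longrightarrow> \<bar>e m\<bar> \<le> M"
  shows "\<bar>(w + \<sigma> * gcoef N \<nu> i i) * e i + \<sigma> * (\<Sum>m\<in>{0..N} - {i}. gcoef N \<nu> i m * e m)\<bar> \<le> w * M"
proof -
  let ?g = "gcoef N \<nu> i"
  have "0 \<le> M" using M[of 0] by simp
  \<comment> \<open>Zero boundary errors remove columns 0 and \<open>N\<close>, which the Toeplitz
    formula does not cover.\<close>
  have "(\<Sum>m\<in>{0..N} - {i}. ?g m * e m) = (\<Sum>m\<in>{1..<N} - {i}. ?g m * e m)"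
  proof (rule sum.mono_neutral_right)
    show "\<forall>m\<in>{0..N} - {i} - ({1..<N} - {i}). ?g m * e m = 0"
    proof
      fix m assume "m \<in> {0..N} - {i} - ({1..<N} - {i})"
      then have "m = 0 \<or> m = N" by auto
      then show "?g m * e m = 0" using bnd by auto
    qed
  qed auto
  also have "\<bar>\<dots>\<bar> \<le> (\<Sum>m\<in>{1..<N} - {i}. ?g m * M)"
    using assms by (intro order_trans[OF sum_abs] sum_mono)
      (auto simp: abs_mult intro!: mult_mono gcoef_offdiag_nonneg)
  also have "\<dots> = ((\<Sum>m\<in>{1..<N}. ?g m) - ?g i) * M"
    using assms by (simp add: sum_distrib_right[symmetric] sum_diff1)
  also have "\<dots> \<le> - ?g i * M"
    using gcoef_interior_row_sum[of \<nu> i N] assms \<open>0 \<le> M\<close> by (intro mult_right_mono) auto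
  finally have "\<sigma> * \<bar>\<Sum>m\<in>{0..N} - {i}. ?g m * e m\<bar> \<le> \<sigma> * (- ?g i * M)"
    using \<open>0 \<le> \<sigma>\<close> by (intro mult_left_mono)
  moreover have "\<bar>(w + \<sigma> * ?g i) * e i\<bar> \<le> (w + \<sigma> * ?g i) * M"
    using diag M[of i] assms by (simp add: abs_mult mult_left_mono)
  moreover have "\<bar>\<sigma> * (\<Sum>m\<in>{0..N} - {i}. ?g m * e m)\<bar> = \<sigma> * \<bar>\<Sum>m\<in>{0..N} - {i}. ?g m * e m\<bar>"
    using \<open>0 \<le> \<sigma>\<close> by (simp add: abs_mult)
  ultimately show ?thesis
    by (smt (verit) abs_triangle_ineq distrib_right mult.assoc mult_minus_left mult_minus_right)
qed

section \<open>The time coefficients\<close>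

lemma lcoef_nonneg: "0 < \<gamma> \<Longrightarrow> \<gamma> \<le> 1 \<Longrightarrow> 0 \<le> lcoef \<gamma> s"
  by (auto simp: lcoef_def intro!: powr_mono2)

text \<open>Links the step condition to the diagonal weight; at \<open>\<gamma> = 1\<close> both
  sides are 1.\<close>

lemma lcoef_1: "1 - lcoef \<gamma> 1 = 2 * (1 - 2 powr (- \<gamma>))"
  using powr_add[of 2 1 "- \<gamma>"] by (auto simp: lcoef_def powr_minus)

text \<open>For \<open>\<gamma> < 1\<close> the increment is the second difference of the concave
  power \<open>1 - \<gamma>\<close> at \<open>s + 1\<close>.\<close>

lemma lcoef_Suc_le:
  assumes "0 < \<gamma>" "\<gamma> \<le> 1" "1 \<le> s"
  shows "lcoef \<gamma> (Suc s) \<le> lcoef \<gamma> s"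
proof (cases "\<gamma> = 1")
  case False
  have "second_diff (\<lambda>x. x powr (1 - \<gamma>)) (real s + 1) \<le> 0"
    using assms by (intro second_diff_powr_nonpos) auto
  then show ?thesis using False by (simp add: lcoef_def second_diff_def algebra_simps)
qed (use assms in \<open>simp add: lcoef_def\<close>)

text \<open>The memory weights are nonnegative and telescope to \<open>lcoef \<gamma> 1\<close>,
  exactly what the self-weight lacks from 1.\<close>

lemma time_sum_bound:
  fixes e :: "nat \<Rightarrow> real"
  assumes "0 < \<gamma>" "\<gamma> \<le> 1" "1 \<le> k" and M: "\<And>j. j \<le> k \<Longrightarrow> \<bar>e j\<bar> \<le> M"
  shows "\<bar>(\<Sum>s = 1..k - 1. (lcoef \<gamma> s - lcoef \<gamma> (s + 1)) * e (k - s)) + lcoef \<gamma> k * e 0\<bar>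
    \<le> lcoef \<gamma> 1 * M"
proof -
  let ?l = "lcoef \<gamma>"
  have "\<bar>\<Sum>s = 1..k - 1. (?l s - ?l (s + 1)) * e (k - s)\<bar> \<le> (\<Sum>s = 1..k - 1. (?l s - ?l (s + 1)) * M)"
    using assms lcoef_Suc_le by (intro order_trans[OF sum_abs] sum_mono)
      (auto simp: abs_mult intro!: mult_mono)
  also have "\<dots> = (?l 1 - ?l k) * M"
  proof -
    have "(\<Sum>s = 1..k - 1. ?l s - ?l (s + 1)) = ?l 1 - ?l k"
      using \<open>1 \<le> k\<close> sum_Suc_diff[of 1 "k - 1" "\<lambda>s. - ?l s"] by simp
    then show ?thesis by (simp only: sum_distrib_right[symmetric])
  qed
  finally have "\<bar>\<Sum>s = 1..k - 1. (?l s - ?l (s + 1)) * e (k - s)\<bar> \<le> (?l 1 - ?l k) * M" .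
  moreover have "\<bar>?l k * e 0\<bar> \<le> ?l k * M"
    using lcoef_nonneg[of \<gamma> k] M[of 0] assms by (simp add: abs_mult mult_left_mono)
  ultimately show ?thesis
    by (smt (verit) abs_triangle_ineq left_diff_distrib)
qed

section \<open>Consequences of the step condition\<close>

lemma kappa_neg:
  assumes "1 < \<alpha>" "\<alpha> \<le> 2"
  shows "kappa \<alpha> < 0"
proof -
  have "cos (\<alpha> * pi / 2) < cos (pi / 2)"
    using assms by (intro cos_monotone_0_pi) (auto simp: field_simps)
  then show ?thesis by (simp add: kappa_def divide_neg_pos field_simps)
qed

lemma le_C_max:
  "i \<le> Nx \<Longrightarrow> k \<le> Nt \<Longrightarrow> c (xmesh xL xR Nx i) (tmesh T Nt k) \<le> C_max xL xR Nx T Nt c"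
  unfolding C_max_def by (rule Max_ge) (auto intro!: image_eqI[where x = "(i, k)"])

lemma sigma_bounds:
  assumes "0 < \<gamma>" "\<gamma> \<le> 1" "1 < \<alpha>" "\<alpha> \<le> 2" "i \<le> Nx" "k \<le> Nt"
    and c: "0 \<le> c (xmesh xL xR Nx i) (tmesh T Nt k)"
    and step: "step_condition \<gamma> \<alpha> xL xR Nx T Nt c"
  shows "0 \<le> sigma \<gamma> \<alpha> xL xR Nx T Nt c i k"
    and "4 * (1 - 2 powr (1 - \<alpha>)) * sigma \<gamma> \<alpha> xL xR Nx T Nt c i k \<le> 1 - 2 powr (- \<gamma>)"
proof -
  let ?c = "c (xmesh xL xR Nx i) (tmesh T Nt k)"
  define r where "r = dt T Nt powr \<gamma> / dx xL xR Nx powr \<alpha>"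
  define C where "C = C_max xL xR Nx T Nt c"
  \<comment> \<open>\<open>sigma\<close> factors as \<open>K * r\<close> times the value of
    \<open>c\<close>; \<open>K\<close> is positive because \<open>kappa \<alpha>\<close> is
    negative.\<close>
  define K where "K = - kappa \<alpha> * Gamma (2 - \<gamma>) / Gamma (4 - \<alpha>)"
  define d where "d = 4 * (1 - 2 powr (1 - \<alpha>))"
  have "0 < r" using step by (simp add: step_condition_def Let_def r_def)
  have G: "0 < Gamma (2 - \<gamma>)" "0 < Gamma (4 - \<alpha>)"
    using assms by (auto intro!: Gamma_real_pos)
  have K: "0 < K" using kappa_neg[of \<alpha>] assms G by (simp add: K_def divide_neg_pos mult_neg_pos)
  have "2 powr (1 - \<alpha>) < (2 :: real) powr 0" using assms by (intro powr_less_mono) auto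
  then have d: "0 < d" by (simp add: d_def)
  have "2 powr (- \<gamma>) \<le> (2 :: real) powr 0" using assms by (intro powr_mono) auto
  then have e: "0 \<le> 1 - 2 powr (- \<gamma>)" by simp
  have C: "?c \<le> C" unfolding C_def using assms by (intro le_C_max)
  have s: "sigma \<gamma> \<alpha> xL xR Nx T Nt c i k = K * r * ?c"
    by (simp add: sigma_def K_def r_def)
  show "0 \<le> sigma \<gamma> \<alpha> xL xR Nx T Nt c i k"
    unfolding s using K \<open>0 < r\<close> c by simp
  have "d * K * r * ?c \<le> 1 - 2 powr (- \<gamma>)"
  proof (cases "C = 0")
    \<comment> \<open>The step condition gives no upper bound here, but
      \<open>0 \<le> ?c \<le> C\<close> forces \<open>?c = 0\<close>.\<close>
    case True
    then show ?thesis using C c e by simp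
  next
    case False
    then have "0 < C" using C c by simp
    have "r \<le> - (Gamma (4 - \<alpha>) * (1 - 2 powr (- \<gamma>)))
                 / (4 * kappa \<alpha> * C * Gamma (2 - \<gamma>) * (1 - 2 powr (1 - \<alpha>)))"
      using step False by (simp add: step_condition_def Let_def r_def C_def)
    also have "\<dots> = (1 - 2 powr (- \<gamma>)) / (d * K * C)"
    proof -
      have "d * K * C = - (4 * kappa \<alpha> * C * Gamma (2 - \<gamma>) * (1 - 2 powr (1 - \<alpha>))) / Gamma (4 - \<alpha>)"
        by (simp add: K_def d_def)
      then show ?thesis using G by (simp only:) (simp add: mult.commute)
    qed
    finally have "d * K * C * r \<le> 1 - 2 powr (- \<gamma>)"
      using d K \<open>0 < C\<close> by (simp add: pos_le_divide_eq mult.commute)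
    moreover have "d * K * r * ?c \<le> d * K * r * C"
      using d K \<open>0 < r\<close> C by (intro mult_left_mono) auto
    ultimately show ?thesis by (simp add: mult_ac)
  qed
  then show "4 * (1 - 2 powr (1 - \<alpha>)) * sigma \<gamma> \<alpha> xL xR Nx T Nt c i k \<le> 1 - 2 powr (- \<gamma>)"
    unfolding s by (simp add: d_def mult.assoc)
qed

lemma xmesh_mem:
  assumes "xL < xR" "0 < Nx" "i \<le> Nx"
  shows "xmesh xL xR Nx i \<in> {xL..xR}"
proof -
  have "real i * (xR - xL) \<le> real Nx * (xR - xL)"
    using assms by (intro mult_right_mono) auto
  then have "real i * (xR - xL) / real Nx \<le> xR - xL"
    using assms by (simp add: pos_divide_le_eq mult.commute)
  moreover have "0 \<le> real i * (xR - xL) / real Nx" using assms by simp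
  ultimately show ?thesis by (simp add: xmesh_def dx_def)
qed

lemma tmesh_mem:
  assumes "0 < T" "0 < Nt" "k \<le> Nt"
  shows "tmesh T Nt k \<in> {0..T}"
  using assms by (simp add: tmesh_def dt_def field_simps)

section \<open>Stability\<close>

theorem theorem3p4:
  fixes \<gamma> \<alpha> xL xR T :: real and Nx Nt :: nat
    and c f :: "real \<Rightarrow> real \<Rightarrow> real" and u u' :: "nat \<Rightarrow> nat \<Rightarrow> real"
  assumes "0 < \<gamma>" "\<gamma> \<le> 1" "1 < \<alpha>" "\<alpha> \<le> 2"
    and "xL < xR" "0 < T" "2 \<le> Nx" "1 \<le> Nt"
    and "\<And>x t. x \<in> {xL..xR} \<Longrightarrow> t \<in> {0..T} \<Longrightarrow> 0 \<le> c x t"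
    and "step_condition \<gamma> \<alpha> xL xR Nx T Nt c"
    and "explicit_scheme \<gamma> \<alpha> xL xR Nx T Nt c f u"
    and "explicit_scheme \<gamma> \<alpha> xL xR Nx T Nt c f u'"
    and "\<And>k. k \<le> Nt \<Longrightarrow> u' 0 k = u 0 k \<and> u' Nx k = u Nx k"
  shows "\<forall>k\<in>{1..Nt}. grid_norm Nx (\<lambda>i. u' i k - u i k) \<le> grid_norm Nx (\<lambda>i. u' i 0 - u i 0)"
proof -
  define e where "e i k = u' i k - u i k" for i k
  define M where "M = grid_norm Nx (\<lambda>i. e i 0)"
  let ?g = "gcoef Nx \<alpha>" and ?l = "lcoef \<gamma>" and ?s = "sigma \<gamma> \<alpha> xL xR Nx T Nt c"
  have e_bnd: "e 0 k = 0" "e Nx k = 0" if "k \<le> Nt" for k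
    using assms(13)[OF that] by (simp_all add: e_def)
  have M0: "\<bar>e i 0\<bar> \<le> M" if "i \<le> Nx" for i
    unfolding M_def grid_norm_def using that by (intro Max_ge) auto
  have "0 \<le> M" using M0[of 0] by simp
  have s: "0 \<le> ?s i k" "0 \<le> (1 - ?l 1) + ?s i k * ?g i i" if "1 \<le> i" "i < Nx" "k \<le> Nt" for i k
  proof -
    \<comment> \<open>Nonnegativity of \<open>c\<close> is assumed on the space-time rectangle, so
      the mesh points must lie in it.\<close>
    have "0 \<le> c (xmesh xL xR Nx i) (tmesh T Nt k)"
      using assms(5-8) that by (intro assms(9) xmesh_mem tmesh_mem) auto
    note b = sigma_bounds[of \<gamma> \<alpha> i Nx k Nt c, OF assms(1-4) _ that(3) this assms(10)]
    show "0 \<le> ?s i k" using b that by simp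
    show "0 \<le> (1 - ?l 1) + ?s i k * ?g i i"
      using b(2) that by (simp only: lcoef_1 gcoef_diag) (simp add: algebra_simps)
  qed
  have step0: "e i 1 = (1 + ?s i 0 * ?g i i) * e i 0 + ?s i 0 * (\<Sum>m\<in>{0..Nx} - {i}. ?g i m * e m 0)"
    if "1 \<le> i" "i < Nx" for i
    using assms(11,12) that
    by (simp add: explicit_scheme_def Let_def e_def algebra_simps sum_subtractf)
  \<comment> \<open>The source terms cancel; the rest is grouped into a spatial part and a memory
    part.\<close>
  have step: "e i (k + 1) = ((1 - ?l 1 + ?s i k * ?g i i) * e i k
        + ?s i k * (\<Sum>m\<in>{0..Nx} - {i}. ?g i m * e m k))
        + ((\<Sum>s = 1..k - 1. (?l s - ?l (s + 1)) * e i (k - s)) + ?l k * e i 0)"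
    if "1 \<le> i" "i < Nx" "0 < k" "k < Nt" for i k
    using assms(11,12) that
    by (simp add: explicit_scheme_def Let_def e_def right_diff_distrib sum_subtractf)
  \<comment> \<open>Strong induction, since the memory part reaches back to all earlier time
    levels.\<close>
  have bound: "\<bar>e i k\<bar> \<le> M" if "k \<le> Nt" "i \<le> Nx" for i k
    using that
  proof (induction k arbitrary: i rule: less_induct)
    case (less k)
    consider "k = 0" | "i = 0 \<or> i = Nx" | "1 \<le> i" "i < Nx" "k = 1" | "1 \<le> i" "i < Nx" "1 < k"
      using less.prems by linarith
    then show ?case
    proof cases
      case 1
      then show ?thesis using M0 less.prems by simp
    next
      case 2
      then show ?thesis using e_bnd less.prems \<open>0 \<le> M\<close> by auto
    next
      case 3
      \<comment> \<open>The self-weight is 1 here, larger than in \<open>s(2)\<close> by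
        \<open>?l 1 \<ge> 0\<close>.\<close>
      have "0 \<le> 1 + ?s i 0 * ?g i i"
        using s(2)[of i 0] 3 lcoef_nonneg[OF assms(1,2), of 1] by simp
      then have "\<bar>e i 1\<bar> \<le> 1 * M"
        unfolding step0[OF 3(1,2)] using assms(3,4) 3 s(1) e_bnd M0
        by (intro space_step_bound) auto
      then show ?thesis using 3 by simp
    next
      case 4
      then obtain j where k: "k = j + 1" and j: "0 < j" "j < Nt"
        using less.prems by (cases k) auto
      have IH: "\<bar>e m n\<bar> \<le> M" if "n \<le> j" "m \<le> Nx" for m n
        using less.IH[of n m] that k j by simp
      have "\<bar>(1 - ?l 1 + ?s i j * ?g i i) * e i j
          + ?s i j * (\<Sum>m\<in>{0..Nx} - {i}. ?g i m * e m j)\<bar> \<le> (1 - ?l 1) * M"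
        using assms(3,4) 4 s[of i j] e_bnd[of j] IH[of j] j by (intro space_step_bound) auto
      moreover have "\<bar>(\<Sum>s = 1..j - 1. (?l s - ?l (s + 1)) * e i (j - s)) + ?l j * e i 0\<bar> \<le> ?l 1 * M"
        using assms(1,2) IH 4 j by (intro time_sum_bound) auto
      ultimately have "\<bar>e i (j + 1)\<bar> \<le> (1 - ?l 1) * M + ?l 1 * M"
        unfolding step[OF 4(1,2) j] by linarith
      then show ?thesis by (simp add: k algebra_simps)
    qed
  qed
  show ?thesis
  proof
    fix k assume "k \<in> {1..Nt}"
    then have "grid_norm Nx (\<lambda>i. e i k) \<le> M"
      unfolding grid_norm_def using bound by (intro Max.boundedI) auto
    then show "grid_norm Nx (\<lambda>i. u' i k - u i k) \<le> grid_norm Nx (\<lambda>i. u' i 0 - u i 0)"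
      by (simp add: M_def e_def)
  qed
qed

end
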